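(* Let $p$ be a prime and let $\mathbb{F}_p$ be the field with $p$ elements. Let $U$ be a non-empty, proper subset of $\mathbb{F}_p\setminus\{0\}$. Let $\pi$ be a permutation of $\mathbb{F}_p$ such that for all $i,j\in\mathbb{F}_p$, $i-j\in U$ implies $\pi(i)-\pi(j)\in U$. Then there are $a,b\in\mathbb{F}_p$ such that $\pi(i)=ai+b$ for all $i\in\mathbb{F}_p$.
   Context: A permutation of $\mathbb{F}_p$ is a bijection of the set $\mathbb{F}_p$ onto itself (no algebraic structure is assumed to be preserved). "Proper subset of $\mathbb{F}_p\setminus\{0\}$" means $U\subseteq\mathbb{F}_p\setminus\{0\}$ and $U\neq\mathbb{F}_p\setminus\{0\}$. *)

theory Defs
  imports "HOL-Computational_Algebra.Primes" "HOL-Library.Cardinality"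
begin

end

theory Submission
  imports Defs "HOL-Computational_Algebra.Polynomial"
begin

text \<open>Let \<open>s\<^sub>k = (\<Sum>u\<in>U. u ^ k)\<close> and let \<open>w\<close> be the least positive index with \<open>s\<^sub>w \<noteq> 0\<close>; comparing
  \<open>U\<close> with its complement shows \<open>2 w < p\<close>. Represent \<open>\<pi>\<close> by a polynomial \<open>P\<close> of degree \<open>n < p\<close>
  and suppose \<open>n \<ge> 2\<close>. Since \<open>u \<mapsto> \<pi> (x + u) - \<pi> x\<close> permutes \<open>U\<close>, the sum
  \<open>(\<Sum>u\<in>U. (\<pi> (x + u) - \<pi> x) ^ k)\<close> equals \<open>s\<^sub>k\<close> for every \<open>x\<close>. Take the least \<open>k\<close> with
  \<open>n k \<ge> w\<close> and write \<open>n k = w + r\<close>. Shifting a polynomial of degree below \<open>w\<close> by the elements of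
  \<open>U\<close> and summing only multiplies it by the size of \<open>U\<close>, so in the binomial expansion of the \<open>k\<close>-th power only
  \<open>P ^ k\<close> matters, and \<open>(\<Sum>u\<in>U. P ^ k (X + u) - P ^ k (X))\<close> is the constant \<open>s\<^sub>k\<close>. Its coefficient
  at \<open>X ^ r\<close> is a non-zero multiple of \<open>s\<^sub>w\<close>, because \<open>w + r < p\<close>. Hence \<open>r = 0\<close> and \<open>s\<^sub>k \<noteq> 0\<close>,
  contradicting \<open>k < w\<close>.\<close>

section \<open>Polynomials: translation and interpolation\<close>

lemma coeff_pcompose_translate:
  fixes P :: "'a::comm_ring_1 poly"
  shows "coeff (P \<circ>\<^sub>p [:u, 1:]) i =
    (\<Sum>j\<le>degree P. coeff P j * of_nat (j choose i) * u ^ (j - i))"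
proof -
  have lin: "coeff ([:u, 1:] ^ j) i = of_nat (j choose i) * u ^ (j - i)" for j
  proof (cases "i \<le> j")
    case False
    have "degree ([:u, 1:] ^ j) \<le> degree [:u, 1:] * j"
      by (rule degree_power_le)
    with False show ?thesis
      by (simp add: coeff_eq_0 binomial_eq_0)
  qed (simp add: coeff_linear_poly_power)
  have "P \<circ>\<^sub>p [:u, 1:] = (\<Sum>j\<le>degree P. smult (coeff P j) ([:u, 1:] ^ j))"
    by (simp add: pcompose_altdef poly_altdef degree_map_poly coeff_map_poly)
  then show ?thesis
    by (simp add: coeff_sum lin mult.assoc)
qed

text \<open>Summing over \<open>U\<close> turns each \<open>u ^ (j - i)\<close> into a power sum.
  Those with 0 < j - i < w vanish and the degree bound excludes j > w + i, so only j = w + i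
  survives.\<close>

lemma coeff_sum_translate_diff:
  fixes P :: "'a::comm_ring_1 poly"
  assumes low: "\<And>k. 0 < k \<Longrightarrow> k < w \<Longrightarrow> (\<Sum>u\<in>U. u ^ k) = 0"
    and "0 < w" and deg: "degree P \<le> w + i"
  shows "coeff (\<Sum>u\<in>U. P \<circ>\<^sub>p [:u, 1:] - P) i =
    coeff P (w + i) * of_nat (w + i choose i) * (\<Sum>u\<in>U. u ^ w)"
proof -
  have trunc: "(\<Sum>j\<le>degree P. coeff P j * of_nat (j choose i) * u ^ (j - i)) =
      (\<Sum>j\<le>w + i. coeff P j * of_nat (j choose i) * u ^ (j - i))" for u
    using deg by (intro sum.mono_neutral_left) (auto simp: coeff_eq_0)
  have one: "coeff (P \<circ>\<^sub>p [:u, 1:] - P) i =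
      (\<Sum>j\<in>{i<..w + i}. coeff P j * of_nat (j choose i) * u ^ (j - i))" for u
  proof -
    have "(\<Sum>j\<le>w + i. coeff P j * of_nat (j choose i) * u ^ (j - i)) =
        (\<Sum>j\<in>{i..w + i}. coeff P j * of_nat (j choose i) * u ^ (j - i))"
      by (intro sum.mono_neutral_right) (auto simp: binomial_eq_0)
    also have "\<dots> = coeff P i + (\<Sum>j\<in>{i<..w + i}. coeff P j * of_nat (j choose i) * u ^ (j - i))"
      by (subst sum.head) auto
    finally show ?thesis
      by (simp add: coeff_pcompose_translate trunc)
  qed
  have "coeff (\<Sum>u\<in>U. P \<circ>\<^sub>p [:u, 1:] - P) i =
      (\<Sum>j\<in>{i<..w + i}. coeff P j * of_nat (j choose i) * (\<Sum>u\<in>U. u ^ (j - i)))"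
    unfolding coeff_sum one by (subst sum.swap) (simp add: sum_distrib_left)
  also have "\<dots> = (\<Sum>j\<in>{w + i}. coeff P j * of_nat (j choose i) * (\<Sum>u\<in>U. u ^ (j - i)))"
  proof (intro sum.mono_neutral_right ballI)
    fix j assume "j \<in> {i<..w + i} - {w + i}"
    then show "coeff P j * of_nat (j choose i) * (\<Sum>u\<in>U. u ^ (j - i)) = 0"
      using low[of "j - i"] by auto
  qed (use \<open>0 < w\<close> in auto)
  finally show ?thesis by simp
qed

lemma sum_poly_translate:
  fixes P :: "'a::comm_ring_1 poly"
  assumes "\<And>k. 0 < k \<Longrightarrow> k < w \<Longrightarrow> (\<Sum>u\<in>U. u ^ k) = 0" and "degree P < w"
  shows "(\<Sum>u\<in>U. poly P (x + u)) = of_nat (card U) * poly P x"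
proof -
  have "(\<Sum>u\<in>U. P \<circ>\<^sub>p [:u, 1:] - P) = 0"
  proof (rule poly_eqI)
    fix i
    have "coeff (\<Sum>u\<in>U. P \<circ>\<^sub>p [:u, 1:] - P) i =
        coeff P (w + i) * of_nat (w + i choose i) * (\<Sum>u\<in>U. u ^ w)"
      by (rule coeff_sum_translate_diff) (use assms in auto)
    then show "coeff (\<Sum>u\<in>U. P \<circ>\<^sub>p [:u, 1:] - P) i = coeff 0 i"
      using assms(2) by (simp add: coeff_eq_0)
  qed
  then have "poly (\<Sum>u\<in>U. P \<circ>\<^sub>p [:u, 1:] - P) x = 0"
    by simp
  then show ?thesis
    by (simp add: poly_sum poly_pcompose sum_subtractf add.commute)
qed

text \<open>Lagrange interpolation through all points of the field.\<close>

lemma exists_interpolating_poly: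
  fixes f :: "'a::{field,finite} \<Rightarrow> 'a"
  obtains P where "degree P < CARD('a)" and "\<And>x. poly P x = f x"
proof
  define L where "L y = (\<Prod>z\<in>UNIV - {y}. smult (inverse (y - z)) [:- z, 1:])" for y :: 'a
  have "degree (L y) \<le> (\<Sum>z\<in>UNIV - {y}. 1)" for y
    unfolding L_def
    by (rule order_trans[OF degree_prod_sum_le]) (auto intro!: sum_mono)
  then have deg: "degree (L y) \<le> CARD('a) - 1" for y
    by (simp add: card_Diff_singleton)
  have val: "poly (L y) x = (if x = y then 1 else 0)" for x y
  proof -
    have "poly (L y) x = (\<Prod>z\<in>UNIV - {y}. inverse (y - z) * (x - z))"
      by (simp add: L_def poly_prod algebra_simps)
    then show ?thesis
      by (auto intro!: prod.neutral)
  qed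
  show "degree (\<Sum>y\<in>UNIV. smult (f y) (L y)) < CARD('a)"
    by (rule degree_sum_less)
      (use deg in \<open>auto simp: zero_less_card_finite intro: le_less_trans[OF degree_smult_le] le_less_trans[OF deg]\<close>)
  show "poly (\<Sum>y\<in>UNIV. smult (f y) (L y)) x = f x" for x
    by (simp add: poly_sum val if_distrib sum.delta cong: if_cong)
qed

section \<open>Power sums over sets of non-zero field elements\<close>

text \<open>Otherwise the polynomial \<open>X \<cdot> \<Prod>(X - u)\<close>, with \<open>u\<close> ranging over all but one element
  of \<open>V\<close>, would have sum zero over \<open>V\<close>, although it is non-zero at exactly one point of \<open>V\<close>.\<close>
lemma exists_power_sum_neq_0:
  fixes V :: "'a::field set"
  assumes "finite V" "V \<noteq> {}" "0 \<notin> V"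
  shows "\<exists>k. 0 < k \<and> k \<le> card V \<and> (\<Sum>v\<in>V. v ^ k) \<noteq> 0"
proof (rule ccontr)
  assume "\<not> ?thesis"
  then have zero: "(\<Sum>v\<in>V. v ^ k) = 0" if "0 < k" "k \<le> card V" for k
    using that by blast
  from \<open>V \<noteq> {}\<close> obtain v0 where v0: "v0 \<in> V" by blast
  define Q where "Q = pCons 0 (\<Prod>u\<in>V - {v0}. [:- u, 1:])"
  have "degree (\<Prod>u\<in>V - {v0}. [:- u, 1:]) \<le> (\<Sum>u\<in>V - {v0}. 1)"
    by (rule order_trans[OF degree_prod_sum_le]) (use assms in auto)
  moreover have "card V > 0"
    using assms by (simp add: card_gt_0_iff)
  ultimately have deg: "degree Q \<le> card V"
    using v0 assms(1) by (auto simp: Q_def degree_pCons_eq_if card_Diff_singleton)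
  have "(\<Sum>v\<in>V. poly Q v) = (\<Sum>i\<le>degree Q. coeff Q i * (\<Sum>v\<in>V. v ^ i))"
    unfolding poly_altdef by (subst sum.swap) (simp add: sum_distrib_left)
  also have "\<dots> = 0"
  proof (rule sum.neutral, intro ballI)
    fix i assume "i \<in> {..degree Q}"
    \<comment> \<open>The factor X of \<open>Q\<close> kills the term i = 0, which
      \<open>zero\<close> does not cover.\<close>
    then show "coeff Q i * (\<Sum>v\<in>V. v ^ i) = 0"
      using deg zero by (cases "i = 0") (auto simp: Q_def)
  qed
  finally have "(\<Sum>v\<in>V. poly Q v) = 0" .
  moreover have "(\<Sum>v\<in>V. poly Q v) = (\<Sum>v\<in>{v0}. poly Q v)"
    using assms v0 by (intro sum.mono_neutral_right) (auto simp: Q_def poly_prod)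
  moreover have "poly Q v0 \<noteq> 0"
    using assms v0 by (auto simp: Q_def poly_prod)
  ultimately show False by simp
qed

text \<open>Multiplication by g permutes the non-zero elements and scales the sum by
  \<open>g ^ k\<close>. Some g has \<open>g ^ k\<close> different from 1, as X^k - 1 has at most k
  roots.\<close>

lemma sum_power_nonzero_eq_0:
  assumes "0 < k" "k < CARD('a::{field,finite}) - 1"
  shows "(\<Sum>x\<in>UNIV - {0::'a}. x ^ k) = 0"
proof -
  have "\<exists>g::'a. g \<noteq> 0 \<and> g ^ k \<noteq> 1"
  proof (rule ccontr)
    assume "\<not> ?thesis"
    then have roots: "UNIV - {0::'a} \<subseteq> {x. poly (monom 1 k - 1) x = 0}"
      by (auto simp: poly_monom)
    have deg: "degree (monom 1 k - 1 :: 'a poly) \<le> k"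
      by (rule degree_diff_le) (auto simp: degree_monom_le)
    have "coeff (monom 1 k - 1 :: 'a poly) k = 1"
      using assms by simp
    then have nz: "(monom 1 k - 1 :: 'a poly) \<noteq> 0"
      by force
    have "card (UNIV - {0::'a}) \<le> card {x::'a. poly (monom 1 k - 1) x = 0}"
      using roots by (intro card_mono) auto
    also have "\<dots> \<le> k"
      using card_poly_roots_bound[OF nz] deg by linarith
    finally show False
      using assms by (simp add: card_Diff_singleton)
  qed
  then obtain g :: 'a where g: "g \<noteq> 0" "g ^ k \<noteq> 1" by blast
  have "g ^ k * (\<Sum>x\<in>UNIV - {0}. x ^ k) = (\<Sum>x\<in>UNIV - {0}. (g * x) ^ k)"
    by (simp add: sum_distrib_left power_mult_distrib)
  also have "\<dots> = (\<Sum>x\<in>UNIV - {0}. x ^ k)"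
    by (rule sum.reindex_bij_witness[of _ "\<lambda>x. x / g" "\<lambda>x. g * x"]) (use g in auto)
  finally show ?thesis using g by simp
qed

text \<open>The smaller of \<open>U\<close> and its complement \<open>W\<close> gives a small
  exponent. If it is \<open>W\<close>, the exponent transfers to \<open>U\<close> because the two
  power sums add up to 0.\<close>

lemma exists_small_power_sum_neq_0:
  fixes U :: "'a::{field,finite} set"
  assumes "U \<noteq> {}" "U \<subset> UNIV - {0}"
  shows "\<exists>k. 0 < k \<and> 2 * k < CARD('a) \<and> (\<Sum>u\<in>U. u ^ k) \<noteq> 0"
proof -
  define W where "W = UNIV - {0} - U"
  have W: "W \<noteq> {}" "0 \<notin> W" and U: "0 \<notin> U"
    using assms by (auto simp: W_def)
  have "card W = card (UNIV - {0::'a}) - card U"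
    unfolding W_def using assms by (intro card_Diff_subset) auto
  moreover have "card U \<le> card (UNIV - {0::'a})"
    using assms by (intro card_mono) auto
  ultimately have card: "card U + card W = CARD('a) - 1"
    by (simp add: card_Diff_singleton)
  have pos: "card U > 0" "card W > 0"
    using assms W by (auto simp: card_gt_0_iff)
  show ?thesis
  proof (cases "2 * card U < CARD('a)")
    case True
    obtain k where k: "0 < k" "k \<le> card U" "(\<Sum>u\<in>U. u ^ k) \<noteq> 0"
      using exists_power_sum_neq_0[of U] assms U by auto
    with True show ?thesis
      by (intro exI[of _ k]) auto
  next
    case False
    then have small: "2 * card W < CARD('a)" "card W < card U"
      using card pos by auto
    obtain k where k: "0 < k" "k \<le> card W" "(\<Sum>u\<in>W. u ^ k) \<noteq> 0"
      using exists_power_sum_neq_0[of W] W by auto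
    have "(\<Sum>u\<in>U. u ^ k) + (\<Sum>u\<in>W. u ^ k) = (\<Sum>u\<in>UNIV - {0}. u ^ k)"
      unfolding W_def using assms by (subst sum.subset_diff[of U "UNIV - {0}"]) auto
    also have "\<dots> = 0"
      by (rule sum_power_nonzero_eq_0) (use k small card in auto)
    finally have "(\<Sum>u\<in>U. u ^ k) \<noteq> 0"
      using k(3) by auto
    with k small show ?thesis
      by (intro exI[of _ k]) auto
  qed
qed

section \<open>Binomial coefficients and the expansion of k-th powers\<close>

lemma of_nat_binomial_neq_0:
  assumes "prime CHAR('a::semiring_1)" "n < CHAR('a)" "k \<le> n"
  shows "of_nat (n choose k) \<noteq> (0::'a)"
proof
  assume "of_nat (n choose k) = (0::'a)"
  then have "CHAR('a) dvd n choose k"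
    by (simp add: of_nat_eq_0_iff_char_dvd)
  also have "(n choose k) dvd fact n"
    using binomial_fact_lemma[OF assms(3)] by (metis dvd_triv_right)
  finally show False
    using assms by (simp add: prime_dvd_fact_iff)
qed

lemma sum_binomial_shift_eq:
  fixes P :: "'a::comm_ring_1 poly"
  assumes low: "\<And>k. 0 < k \<Longrightarrow> k < w \<Longrightarrow> (\<Sum>u\<in>U. u ^ k) = 0"
    and deg: "\<And>j. j < k \<Longrightarrow> degree (P ^ j) < w"
    and "0 < k"
  shows "(\<Sum>u\<in>U. (poly P (x + u) - poly P x) ^ k) =
    (\<Sum>u\<in>U. poly P (x + u) ^ k - poly P x ^ k)"
proof -
  define c where "c j = of_nat (k choose j) * (- poly P x) ^ (k - j)" for j
  have expand: "(y - poly P x) ^ k = y ^ k + (\<Sum>j<k. c j * y ^ j)" for y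
  proof -
    have "(y - poly P x) ^ k = (\<Sum>j\<le>k. of_nat (k choose j) * y ^ j * (- poly P x) ^ (k - j))"
      using binomial_ring[of y "- poly P x" k] by simp
    also have "\<dots> = (\<Sum>j\<le>k. c j * y ^ j)"
      by (simp add: c_def mult_ac)
    also have "\<dots> = (\<Sum>j<k. c j * y ^ j) + c k * y ^ k"
      by (simp flip: lessThan_Suc_atMost)
    finally show ?thesis
      by (simp add: c_def)
  qed
  \<comment> \<open>Setting y = P(x) in the expansion evaluates its lower terms, which reappear
    below multiplied by \<open>card U\<close>.\<close>
  have "poly P x ^ k + (\<Sum>j<k. c j * poly P x ^ j) = 0"
    using expand[of "poly P x"] \<open>0 < k\<close> by (simp add: zero_power)
  then have self: "(\<Sum>j<k. c j * poly P x ^ j) = - (poly P x ^ k)"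
    by (simp add: eq_neg_iff_add_eq_0 add.commute)
  have "(\<Sum>u\<in>U. \<Sum>j<k. c j * poly P (x + u) ^ j) =
      (\<Sum>j<k. c j * (\<Sum>u\<in>U. poly (P ^ j) (x + u)))"
    by (subst sum.swap) (simp add: sum_distrib_left)
  also have "\<dots> = (\<Sum>j<k. c j * (of_nat (card U) * poly (P ^ j) x))"
  proof (rule sum.cong[OF refl])
    fix j assume "j \<in> {..<k}"
    then have "degree (P ^ j) < w" using deg by simp
    from sum_poly_translate[OF low this, where x=x] show
      "c j * (\<Sum>u\<in>U. poly (P ^ j) (x + u)) = c j * (of_nat (card U) * poly (P ^ j) x)"
      by simp
  qed
  also have "\<dots> = of_nat (card U) * (\<Sum>j<k. c j * poly P x ^ j)"
    by (simp add: sum_distrib_left mult_ac)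
  finally show ?thesis
    by (simp add: expand self sum.distrib sum_subtractf)
qed

theorem proposition1:
  fixes p :: nat and U :: "'a::{field,finite} set" and \<pi> :: "'a \<Rightarrow> 'a"
  assumes "prime p"
    and "CARD('a) = p"
    and "U \<noteq> {}"
    and "U \<subset> UNIV - {0}"
    and "bij \<pi>"
    and "\<And>i j. i - j \<in> U \<Longrightarrow> \<pi> i - \<pi> j \<in> U"
  shows "\<exists>a b. \<forall>i. \<pi> i = a * i + b"
proof -
  have "CHAR('a) dvd p"
  proof -
    \<comment> \<open>Translation by 1 permutes the field, so adding 1 to all p summands changes
      nothing.\<close>
    have "(\<Sum>x\<in>UNIV. x + 1) = (\<Sum>x\<in>UNIV. x :: 'a)"
      by (rule sum.reindex_bij_witness[of _ "\<lambda>x. x - 1" "\<lambda>x. x + 1"]) auto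
    then have "of_nat p = (0::'a)"
      using assms(2) by (simp add: sum.distrib)
    then show ?thesis
      by (simp add: of_nat_eq_0_iff_char_dvd)
  qed
  moreover have "CHAR('a) \<noteq> 1"
    by simp
  ultimately have char: "CHAR('a) = p"
    using assms(1) unfolding prime_nat_iff by blast
  define s where "s k = (\<Sum>u\<in>U. u ^ k)" for k
  define w where "w = (LEAST k. 0 < k \<and> s k \<noteq> 0)"
  obtain k0 where k0: "0 < k0" "2 * k0 < p" "s k0 \<noteq> 0"
    using exists_small_power_sum_neq_0[OF assms(3,4)] assms(2) unfolding s_def by auto
  have w: "0 < w" "s w \<noteq> 0"
    using LeastI[of "\<lambda>k. 0 < k \<and> s k \<noteq> 0" k0] k0 unfolding w_def by auto
  have "w \<le> k0"
    unfolding w_def by (rule Least_le) (use k0 in auto)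
  then have w_less: "2 * w < p"
    using k0 by simp
  have low: "s k = 0" if "0 < k" "k < w" for k
    using that not_less_Least[of k "\<lambda>k. 0 < k \<and> s k \<noteq> 0"] unfolding w_def by auto
  obtain P where P: "degree P < p" "\<And>x. poly P x = \<pi> x"
    using exists_interpolating_poly[of \<pi>] assms(2) by auto
  define n where "n = degree P"
  have "n \<le> 1"
  proof (rule ccontr)
    assume "\<not> n \<le> 1"
    then have n: "2 \<le> n" by simp
    \<comment> \<open>This is w / n rounded up.\<close>
    define k where "k = (w - 1) div n + 1"
    define r where "r = n * k - w"
    have "w - 1 = n * (k - 1) + (w - 1) mod n" "(w - 1) mod n < n"
      using n by (auto simp: k_def)
    moreover have "n * k = n * (k - 1) + n"
      by (simp add: k_def)
    ultimately have kr: "n * k = w + r" "r < n" "n * (k - 1) < w"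
      using w unfolding r_def by linarith+
    \<comment> \<open>For k = 1 the left side is n; otherwise r < n < w and 2 w < p.\<close>
    have small: "w + r < p"
    proof (cases "k = 1")
      case True
      then show ?thesis
        using kr P(1) by (simp add: n_def)
    next
      case False
      then have "n * 1 \<le> n * (k - 1)"
        by (intro mult_le_mono2) (simp add: k_def)
      then show ?thesis
        using kr w_less by linarith
    qed
    have "0 < k" by (simp add: k_def)
    have degPk: "degree (P ^ k) = w + r"
      using kr n by (subst degree_power_eq) (auto simp: n_def mult.commute)
    define R where "R = (\<Sum>u\<in>U. P ^ k \<circ>\<^sub>p [:u, 1:] - P ^ k)"
    have "R = [:s k:]"
    \<comment> \<open>Both sides have degree below p, so agreement at all p points suffices.\<close>
    proof (rule poly_eqI_degree[where A=UNIV])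
      fix x
      have "(\<lambda>u. \<pi> (x + u) - \<pi> x) ` U \<subseteq> U"
        using assms(6) by force
      moreover have inj: "inj_on (\<lambda>u. \<pi> (x + u) - \<pi> x) U"
        by (auto intro!: inj_onI simp: inj_eq[OF bij_is_inj[OF assms(5)]])
      ultimately have "(\<lambda>u. \<pi> (x + u) - \<pi> x) ` U = U"
        by (intro endo_inj_surj) auto
      then have "s k = (\<Sum>u\<in>U. (\<pi> (x + u) - \<pi> x) ^ k)"
        unfolding s_def using sum.reindex[OF inj, of "\<lambda>u. u ^ k"] by (simp add: o_def)
      also have "\<dots> = (\<Sum>u\<in>U. \<pi> (x + u) ^ k - \<pi> x ^ k)"
      proof -
        have "degree (P ^ j) < w" if "j < k" for j
        proof -
          have "degree (P ^ j) \<le> n * j"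
            unfolding n_def by (rule degree_power_le)
          also have "\<dots> \<le> n * (k - 1)"
            using that by (intro mult_le_mono2) simp
          finally show ?thesis using kr by simp
        qed
        from sum_binomial_shift_eq[of w U k P x, OF low[unfolded s_def] this \<open>0 < k\<close>]
        show ?thesis by (simp add: P)
      qed
      finally show "poly R x = poly [:s k:] x"
        by (simp add: R_def poly_sum poly_pcompose P add.commute)
    next
      have "degree R \<le> w + r"
        unfolding R_def
      proof (intro degree_sum_le degree_diff_le)
        show "degree (P ^ k \<circ>\<^sub>p [:u, 1:]) \<le> w + r" for u
          using degree_pcompose_le[of "P ^ k" "[:u, 1:]"] degPk by simp
      qed (auto simp: degPk)
      then show "degree R < CARD('a)"
        using small assms(2) by simp
    next
      show "degree [:s k:] < CARD('a)"
        using small assms(2) by simp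
    qed
    moreover have "coeff R r = lead_coeff (P ^ k) * of_nat (w + r choose r) * s w"
      unfolding R_def s_def degPk
      by (rule coeff_sum_translate_diff) (use low w degPk in \<open>auto simp: s_def\<close>)
    moreover have "of_nat (w + r choose r) \<noteq> (0::'a)"
      by (rule of_nat_binomial_neq_0) (use char small assms(1) in auto)
    moreover have "lead_coeff (P ^ k) \<noteq> 0"
      using degPk w by (metis add_is_0 degree_0 leading_coeff_0_iff less_irrefl)
    ultimately have "coeff [:s k:] r \<noteq> 0"
      using w by auto
    \<comment> \<open>A constant polynomial has a non-zero coefficient only at index 0.\<close>
    then have "r = 0" "s k \<noteq> 0"
      by (auto simp: coeff_pCons split: nat.splits)
    \<comment> \<open>Minimality of w gives w <= k, whereas 2 k <= n k = w and w > 0.\<close>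
    then have "w \<le> k"
      using low \<open>0 < k\<close> by (metis not_le)
    moreover have "2 * k \<le> n * k"
      using n by simp
    ultimately show False
      using kr \<open>r = 0\<close> w by simp
  qed
  then have "poly P i = coeff P 1 * i + coeff P 0" for i
    by (cases "n = 0") (auto simp: poly_altdef n_def le_Suc_eq coeff_eq_0 add.commute)
  then show ?thesis
    unfolding P by blast
qed

end
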